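(* Suppose the feasible region $S$ of $(QP)$ is an unbounded polyhedron and let $\mathcal{K} = \mathcal{CP}^{n+1}$. Suppose that $d^TQd \ge 0$ for every $d \in L = \{d \in \mathbb{R}^n : Ad = 0,\ d \ge 0\}$. Then the convex underestimator $\ell_{\mathcal{K}}(\cdot)$ is the convex envelope of $q(\cdot)$ on $S$, i.e., \[ \ell_{\mathcal{K}}(x) = f_S(x), \quad x \in S. \] Therefore, $\ell_{\mathcal{K}} = \ell^*$. In addition, for $\tilde{x} \in S$: one has $\ell_{\mathcal{K}}(\tilde{x}) = \ell^*$ and the optimal solution is attained in $(P(\mathcal{K},\tilde{x}))$ if and only if $\tilde{x} \in \mathrm{conv}(S^* )$.
   Context: Quadratic program: let $Q \in \mathbb{R}^{n\times n}$ be symmetric, $c \in \mathbb{R}^n$, $A \in \mathbb{R}^{m \times n}$, $b \in \mathbb{R}^m$; put $q(x) = x^T Q x + 2c^T x$ and $S = \{x \in \mathbb{R}^n : Ax = b,\ x \ge 0\}$. $(QP)$ is the problem of minimizing $q(x)$ over $x \in S$, with optimal value $\ell^* \in \mathbb{R}\cup\{-\infty,+\infty\}$ ($-\infty$ if unbounded below, $+\infty$ if infeasible). $S^* = \{x^* \in S : q(x^* ) = \ell^*\}$ (empty if $\ell^* = -\infty$), and $\mathrm{conv}(\cdot)$ denotes the convex hull. $\mathcal{S}^N$ denotes the real symmetric $N\times N$ matrices, and $\langle U,V\rangle = \sum_{i,j} U_{ij}V_{ij}$. The cone of completely positive matrices is $\mathcal{CP}^N = \{\sum_{j=1}^k y^j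 (y^j)^T : y^j \in \mathbb{R}^N_+,\ j=1,\ldots,k\} \subseteq \mathcal{S}^N$. Rows and columns of matrices in $\mathcal{S}^{n+1}$ are indexed by $0,1,\ldots,n$. Let \[ \widehat{Q} = \begin{bmatrix} 0 & c^T \\ c & Q\end{bmatrix}, \qquad \widehat{A} = \begin{bmatrix} b^Tb & -b^TA \\ -A^Tb & A^TA\end{bmatrix}. \] $(P(\mathcal{K}))$: minimize $\langle \widehat{Q}, Y\rangle$ subject to $\langle \widehat{A}, Y\rangle = 0$, $Y_{00} = 1$, $Y \in \mathcal{K}$; its optimal value (infimum, possibly $-\infty$) is $\ell_{\mathcal{K}}$. For $\tilde{x} \in S$, $(P(\mathcal{K},\tilde{x}))$ is the same problem with the additional constraint that $(Y_{01},\ldots,Y_{0n})^T = \tilde{x}$; its optimal value (infimum, possibly $-\infty$) is $\ell_{\mathcal{K}}(\tilde{x})$. A function $g : \mathbb{R}^n \to \mathbb{R}$ is a convex underestimator of $q$ on $S$ if $g$ is convex and $g(x) \le q(x)$ for all $x \in S$. The convex envelope of $q$ on $S$ is the pointwise supremum of all of these: $f_S(x) = \sup\{g(x) : g \text{ is a convex underestimator of } q \text{ on } S\}$, $x \in S$.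
   Formalization: Convex underestimators g are only required to be convex on S, not finite and convex on all of R^n; with the latter the claim fails, e.g. for q = -xy on S = {x+s=1, x,s,y >= 0} at (x,s,y) = (0,1,1), where l_K = 0 but f_S <= -1. *)

theory Defs
  imports "HOL-Analysis.Analysis"
begin

section \<open>The quadratic program\<close>

definition qp_objective :: "real^'n^'n \<Rightarrow> real^'n \<Rightarrow> real^'n \<Rightarrow> real" where
  "qp_objective Q c x = x \<bullet> (Q *v x) + 2 * (c \<bullet> x)"

definition qp_feasible :: "real^'n^'m \<Rightarrow> real^'m \<Rightarrow> (real^'n) set" where
  "qp_feasible A b = {x. A *v x = b \<and> 0 \<le> x}"

definition qp_value :: "real^'n^'n \<Rightarrow> real^'n \<Rightarrow> real^'n^'m \<Rightarrow> real^'m \<Rightarrow> ereal" where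
  "qp_value Q c A b = (INF x \<in> qp_feasible A b. ereal (qp_objective Q c x))"

definition qp_solutions ::
    "real^'n^'n \<Rightarrow> real^'n \<Rightarrow> real^'n^'m \<Rightarrow> real^'m \<Rightarrow> (real^'n) set" where
  "qp_solutions Q c A b =
     {x \<in> qp_feasible A b. ereal (qp_objective Q c x) = qp_value Q c A b}"


section \<open>Completely positive matrices and the lifted problems\<close>

definition completely_positive :: "(real^'k^'k) set" where
  "completely_positive =
     {Y. \<exists>(k::nat) (y :: nat \<Rightarrow> real^'k).
           (\<forall>j<k. 0 \<le> y j) \<and> Y = (\<Sum>j<k. \<chi> r s. y j $ r * y j $ s)}"

text \<open>
  Matrices of order \<open>n + 1\<close> are indexed by the type \<^typ>\<open>'n option\<close>: \<^term>\<open>None\<close> is the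
  index \<open>0\<close>, and \<^term>\<open>Some i\<close> is the index \<open>i\<close> of the original space.  The
  trace inner product is the library inner product on \<^typ>\<open>real^'k^'k\<close>.
\<close>

definition block_matrix ::
    "real \<Rightarrow> real^'n \<Rightarrow> real^'n \<Rightarrow> real^'n^'n \<Rightarrow> real^('n option)^('n option)" where
  "block_matrix a u v M =
     (\<chi> r s. case r of
         None \<Rightarrow> (case s of None \<Rightarrow> a | Some j \<Rightarrow> u $ j)
       | Some i \<Rightarrow> (case s of None \<Rightarrow> v $ i | Some j \<Rightarrow> M $ i $ j))"

definition lifted_objective ::
    "real^'n^'n \<Rightarrow> real^'n \<Rightarrow> real^('n option)^('n option)" where
  "lifted_objective Q c = block_matrix 0 c c Q"

definition lifted_constraint ::
    "real^'n^'m \<Rightarrow> real^'m \<Rightarrow> real^('n option)^('n option)" where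
  "lifted_constraint A b =
     block_matrix (b \<bullet> b) (- (b v* A)) (- (transpose A *v b)) (transpose A ** A)"

definition lifted_feasible ::
    "(real^('n option)^('n option)) set \<Rightarrow> real^'n^'m \<Rightarrow> real^'m
       \<Rightarrow> (real^('n option)^('n option)) set" where
  "lifted_feasible K A b = {Y \<in> K. lifted_constraint A b \<bullet> Y = 0 \<and> Y $ None $ None = 1}"

definition lifted_value ::
    "(real^('n option)^('n option)) set
       \<Rightarrow> real^'n^'n \<Rightarrow> real^'n \<Rightarrow> real^'n^'m \<Rightarrow> real^'m \<Rightarrow> ereal" where
  "lifted_value K Q c A b =
     (INF Y \<in> lifted_feasible K A b. ereal (lifted_objective Q c \<bullet> Y))"

definition lifted_feasible_at ::
    "(real^('n option)^('n option)) set \<Rightarrow> real^'n^'m \<Rightarrow> real^'m \<Rightarrow> real^'n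
       \<Rightarrow> (real^('n option)^('n option)) set" where
  "lifted_feasible_at K A b x =
     {Y \<in> lifted_feasible K A b. (\<chi> i. Y $ None $ Some i) = x}"

definition lifted_value_at ::
    "(real^('n option)^('n option)) set
       \<Rightarrow> real^'n^'n \<Rightarrow> real^'n \<Rightarrow> real^'n^'m \<Rightarrow> real^'m \<Rightarrow> real^'n \<Rightarrow> ereal" where
  "lifted_value_at K Q c A b x =
     (INF Y \<in> lifted_feasible_at K A b x. ereal (lifted_objective Q c \<bullet> Y))"

definition lifted_attained_at ::
    "(real^('n option)^('n option)) set
       \<Rightarrow> real^'n^'n \<Rightarrow> real^'n \<Rightarrow> real^'n^'m \<Rightarrow> real^'m \<Rightarrow> real^'n \<Rightarrow> bool" where
  "lifted_attained_at K Q c A b x \<longleftrightarrow>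
     (\<exists>Y \<in> lifted_feasible_at K A b x.
        ereal (lifted_objective Q c \<bullet> Y) = lifted_value_at K Q c A b x)"


section \<open>Convex envelopes\<close>

text \<open>
  Convexity of an underestimator is required on \<open>S\<close> only; its values outside \<open>S\<close> are
  irrelevant.  This amounts to admitting convex underestimators on the whole space with
  values in the reals extended by \<open>+\<infinity>\<close>.  Finite convex functions on the whole space are
  continuous, so using only those would give the lower semicontinuous convex envelope,
  which may be strictly smaller at relative boundary points of an unbounded \<open>S\<close>: for
  the function \<open>(x, y) \<mapsto> - x * y\<close> on \<open>[0, 1] \<times> [0, \<infinity>)\<close> and the point \<open>(0, 1)\<close>, the
  envelope is \<open>0\<close>, but its lower semicontinuous version is \<open>- 1\<close>.
\<close>

definition convex_underestimator ::
    "('a::real_vector \<Rightarrow> real) \<Rightarrow> 'a set \<Rightarrow> ('a \<Rightarrow> real) \<Rightarrow> bool" where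
  "convex_underestimator q S g \<longleftrightarrow> convex_on S g \<and> (\<forall>x\<in>S. g x \<le> q x)"

definition convex_envelope ::
    "('a::real_vector \<Rightarrow> real) \<Rightarrow> 'a set \<Rightarrow> 'a \<Rightarrow> ereal" where
  "convex_envelope q S x = (SUP g \<in> {g. convex_underestimator q S g}. ereal (g x))"

end

theory Submission
  imports Defs
begin

text \<open>
  A rank one decomposition of a lifted feasible matrix reads as a convex combination of feasible
  points plus recession directions \<open>d\<close>, and the latter only add the terms \<open>d \<bullet> Q d \<ge> 0\<close>.  Hence
  the lifted value at \<open>x\<close> is the infimum of the averages of \<open>q\<close> over convex combinations with
  barycentre \<open>x\<close>.  Every convex underestimator lies below it by Jensen's inequality, and it is
  itself such an underestimator once it is known to be finite.  Finiteness comes from an affine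
  minorant of \<open>q\<close>: writing feasible points as \<open>v + d\<close> with \<open>v\<close> bounded and \<open>d\<close> a recession
  direction, \<open>q\<close> is bounded below by a function affine in \<open>\<Sum>i. x $ i\<close>.
\<close>

section \<open>Completely positive matrices\<close>

definition outer_square :: "real^'k \<Rightarrow> real^'k^'k" where
  "outer_square y = (\<chi> r s. y $ r * y $ s)"

lemma completely_positiveI:
  fixes y :: "nat \<Rightarrow> real^'k"
  assumes "\<And>j. j < k \<Longrightarrow> 0 \<le> y j"
  shows "(\<Sum>j<k. outer_square (y j)) \<in> completely_positive"
  unfolding completely_positive_def outer_square_def using assms by auto

lemma completely_positiveE:
  fixes Y :: "real^'k^'k"
  assumes "Y \<in> completely_positive"
  obtains k y where "\<forall>j<k. 0 \<le> y j" "Y = (\<Sum>j<(k::nat). outer_square (y j))"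
  using assms unfolding completely_positive_def outer_square_def by auto

lemma outer_square_scaleR: "outer_square (a *\<^sub>R y) = (a\<^sup>2) *\<^sub>R outer_square y"
  by (simp add: outer_square_def vec_eq_iff power2_eq_square)

lemma outer_square_completely_positive:
  assumes "0 \<le> y"
  shows "outer_square y \<in> completely_positive"
  using completely_positiveI[of 1 "\<lambda>_. y"] assms by simp

text \<open>\<open>outer_square\<close> is homogeneous of degree two, so a nonnegative factor enters
  each generator as its square root.\<close>

lemma completely_positive_scaleR:
  fixes Y :: "real^'k^'k"
  assumes "Y \<in> completely_positive" "0 \<le> a"
  shows "a *\<^sub>R Y \<in> completely_positive"
proof -
  obtain k :: nat and y where y: "\<forall>j<k. 0 \<le> y j" and Y: "Y = (\<Sum>j<k. outer_square (y j))"
    using assms(1) by (rule completely_positiveE)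
  have "a *\<^sub>R Y = (\<Sum>j<k. outer_square (sqrt a *\<^sub>R y j))"
    using assms(2) by (simp add: Y scaleR_sum_right outer_square_scaleR)
  also have "\<dots> \<in> completely_positive"
    using y assms(2) by (intro completely_positiveI) (simp add: less_eq_vec_def)
  finally show ?thesis .
qed

text \<open>The two families of generators are concatenated. Together with closure under scaling
  this makes the cone convex, as the averaging of lifted matrices requires.\<close>

lemma completely_positive_add:
  fixes Y Z :: "real^'k^'k"
  assumes "Y \<in> completely_positive" "Z \<in> completely_positive"
  shows "Y + Z \<in> completely_positive"
proof -
  obtain k :: nat and y where y: "\<forall>j<k. 0 \<le> y j" and Y: "Y = (\<Sum>j<k. outer_square (y j))"
    using assms(1) by (rule completely_positiveE)
  obtain l :: nat and z where z: "\<forall>j<l. 0 \<le> z j" and Z: "Z = (\<Sum>j<l. outer_square (z j))"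
    using assms(2) by (rule completely_positiveE)
  define w where "w j = (if j < k then y j else z (j - k))" for j
  have "(\<Sum>j<k + l. outer_square (w j))
      = (\<Sum>j<k. outer_square (w j)) + (\<Sum>j=k..<k + l. outer_square (w j))"
    by (simp add: sum.atLeastLessThan_concat lessThan_atLeast0)
  also have "(\<Sum>j=k..<k + l. outer_square (w j)) = (\<Sum>j<l. outer_square (w (k + j)))"
    using sum.shift_bounds_nat_ivl[of "\<lambda>j. outer_square (w j)" 0 k l]
    by (simp add: add.commute lessThan_atLeast0)
  finally have "Y + Z = (\<Sum>j<k + l. outer_square (w j))"
    by (simp add: Y Z w_def)
  also have "\<dots> \<in> completely_positive"
    using y z by (intro completely_positiveI) (simp add: w_def)
  finally show ?thesis .
qed

section \<open>The lifted problem\<close>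

text \<open>The vector \<open>(t, z)\<close> of order n + 1: \<open>t\<close> is the homogenizing
  coordinate at index \<open>None\<close>, so for \<open>t > 0\<close> it represents the point
  \<open>z / t\<close>.\<close>

definition homogenized :: "real \<Rightarrow> real^'n \<Rightarrow> real^('n option)" where
  "homogenized t z = (\<chi> r. case r of None \<Rightarrow> t | Some i \<Rightarrow> z $ i)"

lemma homogenized_nth [simp]:
  "homogenized t z $ None = t" "homogenized t z $ Some i = z $ i"
  by (simp_all add: homogenized_def)

lemma homogenized_exhaust:
  fixes y :: "real^(('n::finite) option)"
  obtains t z where "y = homogenized t z"
proof
  show "y = homogenized (y $ None) (\<chi> i. y $ Some i)"
    by (simp add: vec_eq_iff homogenized_def split: option.split)
qed

lemma homogenized_nonneg_iff: "0 \<le> homogenized t z \<longleftrightarrow> 0 \<le> t \<and> 0 \<le> z"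
proof -
  have "(\<forall>r. 0 \<le> homogenized t z $ r)
      \<longleftrightarrow> 0 \<le> homogenized t z $ None \<and> (\<forall>i. 0 \<le> homogenized t z $ Some i)"
    by (metis not_None_eq)
  then show ?thesis
    by (simp add: less_eq_vec_def)
qed

lemma sum_UNIV_option:
  "(\<Sum>r\<in>(UNIV::('n::finite) option set). f r) = f None + (\<Sum>i\<in>UNIV. f (Some i))"
  by (simp add: UNIV_option_conv sum.reindex)

text \<open>Pairing a matrix with \<open>outer_square y\<close> evaluates its quadratic form at
  \<open>y\<close>; the four terms come from the four blocks.\<close>

lemma inner_block_matrix_outer_square:
  "block_matrix a u v M \<bullet> outer_square (homogenized t z)
     = a * t\<^sup>2 + t * (u \<bullet> z) + t * (v \<bullet> z) + z \<bullet> (M *v z)"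
proof -
  have "block_matrix a u v M \<bullet> outer_square (homogenized t z)
      = a * (t * t) + (\<Sum>j\<in>UNIV. u $ j * (t * z $ j))
        + (\<Sum>i\<in>UNIV. v $ i * (z $ i * t) + (\<Sum>j\<in>UNIV. M $ i $ j * (z $ i * z $ j)))"
    by (simp add: block_matrix_def outer_square_def inner_vec_def sum_UNIV_option)
  also have "(\<Sum>j\<in>UNIV. u $ j * (t * z $ j)) = t * (u \<bullet> z)"
    unfolding inner_vec_def sum_distrib_left by (rule sum.cong) auto
  also have "(\<Sum>i\<in>UNIV. v $ i * (z $ i * t) + (\<Sum>j\<in>UNIV. M $ i $ j * (z $ i * z $ j)))
      = (\<Sum>i\<in>UNIV. t * (v $ i * z $ i)) + (\<Sum>i\<in>UNIV. z $ i * (\<Sum>j\<in>UNIV. M $ i $ j * z $ j))"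
    unfolding sum.distrib sum_distrib_left
    by (intro arg_cong2[of _ _ _ _ "(+)"] sum.cong) auto
  also have "(\<Sum>i\<in>UNIV. t * (v $ i * z $ i)) = t * (v \<bullet> z)"
    by (simp add: inner_vec_def sum_distrib_left)
  also have "(\<Sum>i\<in>UNIV. z $ i * (\<Sum>j\<in>UNIV. M $ i $ j * z $ j)) = z \<bullet> (M *v z)"
    by (simp add: inner_vec_def matrix_vector_mult_def)
  finally show ?thesis
    by (simp add: power2_eq_square)
qed

lemma inner_lifted_objective:
  "lifted_objective Q c \<bullet> outer_square (homogenized t z) = z \<bullet> (Q *v z) + 2 * t * (c \<bullet> z)"
  by (simp add: lifted_objective_def inner_block_matrix_outer_square)

text \<open>The constraint matrix is the Gram matrix of the block row \<open>[-b, A]\<close>, so its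
  quadratic form is a squared residual and in particular nonnegative.\<close>

lemma inner_lifted_constraint:
  "lifted_constraint A b \<bullet> outer_square (homogenized t z) = (norm (A *v z - t *\<^sub>R b))\<^sup>2"
proof -
  have "z \<bullet> ((transpose A ** A) *v z) = (A *v z) \<bullet> (A *v z)"
    by (metis dot_lmul_matrix inner_commute matrix_vector_mul_assoc transpose_matrix_vector)
  moreover have "(b v* A) \<bullet> z = b \<bullet> (A *v z)"
    by (rule dot_lmul_matrix)
  ultimately show ?thesis
    unfolding lifted_constraint_def inner_block_matrix_outer_square power2_norm_eq_inner
    by (simp add: algebra_simps inner_commute power2_eq_square)
qed

text \<open>The rank one lift of \<open>(1, x)\<close> makes the fibre over a feasible point
  nonempty and bounds its lifted value above by the objective at \<open>x\<close>.\<close>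

lemma lifted_feasible_at_outer_square:
  assumes "x \<in> qp_feasible A b"
  shows "outer_square (homogenized 1 x) \<in> lifted_feasible_at completely_positive A b x"
    and "lifted_objective Q c \<bullet> outer_square (homogenized 1 x) = qp_objective Q c x"
proof -
  have Ax: "A *v x = b" and "0 \<le> x"
    using assms by (auto simp: qp_feasible_def)
  then have "outer_square (homogenized 1 x) \<in> completely_positive"
    by (simp add: outer_square_completely_positive homogenized_nonneg_iff)
  moreover have "lifted_constraint A b \<bullet> outer_square (homogenized 1 x) = 0"
    by (simp add: inner_lifted_constraint Ax)
  moreover have "outer_square (homogenized 1 x) $ None $ None = 1"
    "(\<chi> i. outer_square (homogenized 1 x) $ None $ Some i) = x"
    by (simp_all add: outer_square_def)
  ultimately show "outer_square (homogenized 1 x) \<in> lifted_feasible_at completely_positive A b x"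
    by (simp add: lifted_feasible_at_def lifted_feasible_def)
  show "lifted_objective Q c \<bullet> outer_square (homogenized 1 x) = qp_objective Q c x"
    by (simp add: inner_lifted_objective qp_objective_def)
qed

text \<open>All constraints are affine in the matrix and the cone is convex. This serves both the
  convexity of the fibrewise infimum and the passage to convex hulls of solutions.\<close>

lemma lifted_feasible_at_convex_combination:
  assumes Y: "Y \<in> lifted_feasible_at completely_positive A b x"
    and Z: "Z \<in> lifted_feasible_at completely_positive A b y"
    and uv: "0 \<le> u" "0 \<le> v" "u + v = 1"
  shows "u *\<^sub>R Y + v *\<^sub>R Z \<in> lifted_feasible_at completely_positive A b (u *\<^sub>R x + v *\<^sub>R y)"
proof -
  let ?W = "u *\<^sub>R Y + v *\<^sub>R Z"
  have "?W \<in> completely_positive"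
    using Y Z uv by (intro completely_positive_add completely_positive_scaleR)
      (simp_all add: lifted_feasible_at_def lifted_feasible_def)
  moreover have "lifted_constraint A b \<bullet> ?W = 0" "?W $ None $ None = 1"
    using Y Z uv by (simp_all add: lifted_feasible_at_def lifted_feasible_def inner_add_right)
  moreover have "(\<chi> i. ?W $ None $ Some i)
      = u *\<^sub>R (\<chi> i. Y $ None $ Some i) + v *\<^sub>R (\<chi> i. Z $ None $ Some i)"
    by (simp add: vec_eq_iff)
  ultimately show ?thesis
    using Y Z by (simp add: lifted_feasible_at_def lifted_feasible_def)
qed

text \<open>
  Homogeneous coordinates \<open>(t, z)\<close> of a rank one summand with \<open>t > 0\<close> give the point \<open>z / t\<close> of
  the feasible region with weight \<open>t\<^sup>2\<close>; those with \<open>t = 0\<close> are recession directions and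
  contribute only to the rest \<open>\<rho>\<close> of the objective.
\<close>

lemma lifted_feasible_decompose:
  fixes Q :: "real^'n^'n" and A :: "real^'n^'m"
  assumes Y: "Y \<in> lifted_feasible completely_positive A b"
    and rec: "\<And>d. A *v d = 0 \<Longrightarrow> 0 \<le> d \<Longrightarrow> d \<bullet> (Q *v d) \<ge> 0"
  obtains J :: "nat set" and w :: "nat \<Rightarrow> real" and X :: "nat \<Rightarrow> real^'n" and \<rho> :: real
  where "finite J" "\<forall>j\<in>J. 0 < w j" "\<forall>j\<in>J. X j \<in> qp_feasible A b"
    "sum w J = 1" "(\<chi> i. Y $ None $ Some i) = (\<Sum>j\<in>J. w j *\<^sub>R X j)"
    "lifted_objective Q c \<bullet> Y = (\<Sum>j\<in>J. w j * qp_objective Q c (X j)) + \<rho>" "0 \<le> \<rho>"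
proof -
  have "Y \<in> completely_positive"
    using Y by (simp add: lifted_feasible_def)
  then obtain k :: nat and y where y: "\<forall>j<k. 0 \<le> y j"
    and Y_eq: "Y = (\<Sum>j<k. outer_square (y j))"
    by (rule completely_positiveE)
  have "\<exists>t z. y j = homogenized t z" for j
    by (metis homogenized_exhaust)
  then obtain t z where yj: "\<And>j. y j = homogenized (t j) (z j)"
    by metis
  have nonneg: "0 \<le> t j" "0 \<le> z j" if "j < k" for j
    using y that by (auto simp: yj homogenized_nonneg_iff)
  have "(\<Sum>j<k. (norm (A *v z j - t j *\<^sub>R b))\<^sup>2) = 0"
    using Y by (simp add: lifted_feasible_def Y_eq yj inner_sum_right inner_lifted_constraint)
  \<comment> \<open>A vanishing sum of squares makes every residual zero: summands with
    \<open>t j > 0\<close> rescale to solutions of \<open>A *v x = b\<close>, those with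
    \<open>t j = 0\<close> lie in the kernel of \<open>A\<close>.\<close>
  then have Az: "A *v z j = t j *\<^sub>R b" if "j < k" for j
    using that by (simp add: sum_nonneg_eq_0_iff)
  define J where "J = {j. j < k \<and> 0 < t j}"
  define R where "R = {j. j < k \<and> t j = 0}"
  \<comment> \<open>The summand type stays general because the splitting is applied to real sums and
    to vector sums.\<close>
  have split: "(\<Sum>j<k. f j) = sum f J + sum f R" for f :: "nat \<Rightarrow> 'z::comm_monoid_add"
  proof -
    have "{..<k} = J \<union> R"
      using nonneg(1) unfolding J_def R_def by (auto simp: less_le)
    then show ?thesis
      by (simp add: sum.union_disjoint J_def R_def disjoint_iff)
  qed
  \<comment> \<open>Squares are the right weights: the corner entry of \<open>Y\<close>, which is 1,
    is the sum of all \<open>t j * t j\<close>, and \<open>w j *\<^sub>R X j\<close> equals the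
    first row contribution \<open>t j *\<^sub>R z j\<close>.\<close>
  define w where "w j = (t j)\<^sup>2" for j
  define X where "X j = z j /\<^sub>R t j" for j
  define \<rho> where "\<rho> = (\<Sum>j\<in>R. z j \<bullet> (Q *v z j))"
  show thesis
  proof (rule that)
    show "finite J"
      by (simp add: J_def)
    show "\<forall>j\<in>J. 0 < w j"
      by (simp add: J_def w_def)
    show "\<forall>j\<in>J. X j \<in> qp_feasible A b"
    proof
      fix j assume "j \<in> J"
      then show "X j \<in> qp_feasible A b"
        using Az[of j] nonneg[of j]
        by (simp add: qp_feasible_def X_def J_def matrix_vector_mult_scaleR less_eq_vec_def)
    qed
    have "Y $ None $ None = (\<Sum>j<k. w j)"
      by (simp add: Y_eq outer_square_def yj w_def power2_eq_square)
    then show "sum w J = 1"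
      using Y by (simp add: lifted_feasible_def split) (simp add: R_def w_def)
    have "(\<chi> i. Y $ None $ Some i) = (\<Sum>j<k. t j *\<^sub>R z j)"
      by (simp add: Y_eq outer_square_def yj vec_eq_iff)
    also have "\<dots> = (\<Sum>j\<in>J. w j *\<^sub>R X j)"
      unfolding split by (simp add: J_def R_def w_def X_def power2_eq_square mult.assoc)
    finally show "(\<chi> i. Y $ None $ Some i) = (\<Sum>j\<in>J. w j *\<^sub>R X j)" .
    have obj: "w j * qp_objective Q c (X j) = z j \<bullet> (Q *v z j) + 2 * t j * (c \<bullet> z j)"
      if "j \<in> J" for j
      using that by (simp add: J_def w_def X_def qp_objective_def matrix_vector_mult_scaleR
          power2_eq_square field_simps)
    have "lifted_objective Q c \<bullet> Y = (\<Sum>j<k. z j \<bullet> (Q *v z j) + 2 * t j * (c \<bullet> z j))"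
      by (simp add: Y_eq yj inner_sum_right inner_lifted_objective)
    also have "\<dots> = (\<Sum>j\<in>J. w j * qp_objective Q c (X j)) + \<rho>"
      unfolding split by (simp add: obj) (simp add: \<rho>_def R_def)
    finally show "lifted_objective Q c \<bullet> Y = (\<Sum>j\<in>J. w j * qp_objective Q c (X j)) + \<rho>" .
    show "0 \<le> \<rho>"
      unfolding \<rho>_def using Az nonneg by (intro sum_nonneg rec) (auto simp: R_def)
  qed
qed

section \<open>An affine minorant of the objective\<close>

lemma convex_qp_feasible: "convex (qp_feasible A b)"
  unfolding convex_def qp_feasible_def
  by (auto simp: matrix_vector_right_distrib matrix_vector_mult_scaleR less_eq_vec_def
      simp flip: scaleR_left_distrib)

text \<open>An unbounded sequence in the face is normalized; compactness of the unit sphere gives a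
  limit direction, nonzero because it has norm 1. The sign and support conditions are closed and
  pass to the limit.\<close>

lemma unbounded_face_recession:
  fixes A :: "real^'n^'m"
  assumes "\<not> bounded {x \<in> qp_feasible A b. \<forall>i. i \<notin> J \<longrightarrow> x $ i = 0}" (is "\<not> bounded ?F")
  obtains d where "d \<noteq> 0" "A *v d = 0" "0 \<le> d" "\<forall>i. i \<notin> J \<longrightarrow> d $ i = 0"
proof -
  have "\<forall>n. \<exists>x. x \<in> ?F \<and> real (Suc n) < norm x"
    using assms unfolding bounded_iff by (meson not_le)
  from choice[OF this] obtain x where
    x: "\<And>n. x n \<in> ?F" and nx: "\<And>n. real (Suc n) < norm (x n)"
    by blast
  define y where "y n = x n /\<^sub>R norm (x n)" for n
  have pos: "0 < norm (x n)" for n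
    using nx[of n] by linarith
  have "y n \<in> sphere 0 1" for n
    using pos[of n] by (simp add: y_def)
  then obtain d r where d: "d \<in> sphere 0 1" and r: "strict_mono r"
    and lim: "(y \<circ> r) \<longlonglongrightarrow> d"
    using compact_sphere[of "0::real^'n" 1] unfolding compact_def by metis
  \<comment> \<open>\<open>A *v y n\<close> is \<open>b\<close> divided by
    \<open>norm (x n)\<close>, and these norms exceed \<open>Suc n\<close>; hence the limit
    direction lies in the kernel of \<open>A\<close>.\<close>
  have "(\<lambda>n. norm (b /\<^sub>R norm (x n))) \<longlonglongrightarrow> 0"
  proof (rule tendsto_sandwich[where f = "\<lambda>_. 0" and h = "\<lambda>n. norm b * inverse (real (Suc n))"])
    show "\<forall>\<^sub>F n in sequentially. norm (b /\<^sub>R norm (x n)) \<le> norm b * inverse (real (Suc n))"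
    proof (rule always_eventually, rule allI)
      fix n
      have "inverse (norm (x n)) \<le> inverse (real (Suc n))"
        using nx[of n] by (intro le_imp_inverse_le) auto
      then show "norm (b /\<^sub>R norm (x n)) \<le> norm b * inverse (real (Suc n))"
        by (simp add: mult.commute mult_left_mono del: of_nat_Suc)
    qed
    show "(\<lambda>n. norm b * inverse (real (Suc n))) \<longlonglongrightarrow> 0"
      using tendsto_mult_right_zero[OF LIMSEQ_inverse_real_of_nat] .
  qed auto
  then have "(\<lambda>n. b /\<^sub>R norm (x n)) \<longlonglongrightarrow> 0"
    by (simp only: tendsto_norm_zero_iff)
  then have "((\<lambda>n. b /\<^sub>R norm (x n)) \<circ> r) \<longlonglongrightarrow> 0"
    using r by (rule LIMSEQ_subseq_LIMSEQ)
  moreover have "b /\<^sub>R norm (x n) = A *v y n" for n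
    using x[of n] by (simp add: y_def qp_feasible_def matrix_vector_mult_scaleR)
  ultimately have "(\<lambda>n. A *v (y \<circ> r) n) \<longlonglongrightarrow> 0"
    by (simp add: o_def)
  moreover have "(\<lambda>n. A *v (y \<circ> r) n) \<longlonglongrightarrow> A *v d"
    using lim by (rule bounded_linear.tendsto[OF matrix_vector_mul_bounded_linear])
  ultimately have "A *v d = 0"
    using LIMSEQ_unique by blast
  have coord: "(\<lambda>n. (y \<circ> r) n $ i) \<longlonglongrightarrow> d $ i" for i
    using lim by (rule tendsto_vec_nth)
  have "0 \<le> d $ i" for i
    using x pos
    by (intro LIMSEQ_le_const[OF coord]) (auto simp: y_def qp_feasible_def less_eq_vec_def)
  moreover have "d $ i = 0" if "i \<notin> J" for i
  proof -
    have "(\<lambda>n. (y \<circ> r) n $ i) = (\<lambda>n. 0)"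
      using x that by (auto simp: y_def)
    then show ?thesis
      using coord[of i] by (simp add: LIMSEQ_const_iff)
  qed
  ultimately show thesis
    using d \<open>A *v d = 0\<close> by (intro that[of d]) (auto simp: less_eq_vec_def)
qed

text \<open>
  Subtracting from \<open>x\<close> a largest recession direction below \<open>x\<close> leaves a point whose support
  carries no recession direction, so it lies in one of finitely many bounded faces.
\<close>

lemma qp_feasible_decompose:
  fixes A :: "real^'n^'m"
  obtains B where "0 \<le> B"
    "\<And>x. x \<in> qp_feasible A b \<Longrightarrow>
       \<exists>v d. x = v + d \<and> norm v \<le> B \<and> 0 \<le> v \<and> 0 \<le> d \<and> A *v d = 0"
proof -
  define F where "F J = {x \<in> qp_feasible A b. \<forall>i. i \<notin> J \<longrightarrow> x $ i = 0}" for J :: "'n set"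
  \<comment> \<open>There are finitely many supports \<open>J\<close>, so one bound serves all
    bounded faces.\<close>
  have "bounded (\<Union>J\<in>{J. bounded (F J)}. F J)"
    by (intro bounded_UN) auto
  then obtain B where B: "0 < B" "\<And>J v. bounded (F J) \<Longrightarrow> v \<in> F J \<Longrightarrow> norm v \<le> B"
    unfolding bounded_pos by blast
  show thesis
  proof (rule that[of B])
    fix x assume x: "x \<in> qp_feasible A b"
    \<comment> \<open>The recession directions below \<open>x\<close> form a compact set, a box cut
      by the closed kernel of \<open>A\<close>, so one with largest coordinate sum exists.\<close>
    define D where "D = {d \<in> {0..x}. A *v d = 0}"
    have "continuous_on UNIV ((*v) A)"
      by (simp add: linear_continuous_on)
    then have "closed ((*v) A -` {0})"
      by (intro closed_vimage) (auto simp: continuous_on_eq_continuous_within)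
    then have "compact ({0..x} \<inter> ((*v) A -` {0}))"
      by (intro compact_Int_closed) auto
    then have "compact D"
      by (simp add: D_def vimage_def Int_def conj_commute)
    moreover have "0 \<in> D"
      using x by (simp add: D_def qp_feasible_def)
    moreover have "continuous_on D (\<lambda>d. \<Sum>i\<in>UNIV. d $ i)"
      by (intro continuous_intros)
    ultimately obtain d where d: "d \<in> D"
      and max: "\<And>e. e \<in> D \<Longrightarrow> (\<Sum>i\<in>UNIV. e $ i) \<le> (\<Sum>i\<in>UNIV. d $ i)"
      using continuous_attains_sup[of D "\<lambda>d. \<Sum>i\<in>UNIV. d $ i"] by blast
    define v where "v = x - d"
    define J where "J = {i. v $ i \<noteq> 0}"
    have v0: "0 \<le> v" and d0: "0 \<le> d" "A *v d = 0"
      using d by (auto simp: v_def D_def less_eq_vec_def)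
    have "v \<in> F J"
      using x v0 d0 by (simp add: F_def J_def qp_feasible_def v_def matrix_vector_mult_diff_distrib)
    moreover have "bounded (F J)"
    proof (rule ccontr)
      assume "\<not> bounded (F J)"
      then obtain e where e: "e \<noteq> 0" "A *v e = 0" "0 \<le> e" "\<forall>i. i \<notin> J \<longrightarrow> e $ i = 0"
        unfolding F_def by (rule unbounded_face_recession)
      have e0: "0 \<le> e $ i" for i
        using e(3) by (simp add: less_eq_vec_def)
      obtain k where k: "e $ k \<noteq> 0"
        using e(1) by (auto simp: vec_eq_iff)
      then have kJ: "k \<in> J"
        using e(4) by blast
      have s: "0 < (\<Sum>i\<in>UNIV. e $ i)"
        using e0 k by (intro sum_pos2[of _ k]) (auto simp: less_le)
      define m where "m = Min ((\<lambda>i. v $ i) ` J)"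
      have "0 < m"
        unfolding m_def using kJ v0 by (subst Min_gr_iff) (auto simp: J_def less_eq_vec_def less_le)
      \<comment> \<open>The smallest positive coordinate of \<open>v\<close> over the total of
        \<open>e\<close>: this keeps \<open>\<epsilon> * e $ i\<close> below \<open>v $ i\<close>
        everywhere, so \<open>d + \<epsilon> *\<^sub>R e\<close> stays below \<open>x\<close> with a
        larger coordinate sum than the maximal \<open>d\<close>.\<close>
      define \<epsilon> where "\<epsilon> = m / (\<Sum>i\<in>UNIV. e $ i)"
      have "0 < \<epsilon>"
        using s \<open>0 < m\<close> by (simp add: \<epsilon>_def)
      have "\<epsilon> * e $ i \<le> v $ i" for i
      proof (cases "i \<in> J")
        case True
        have "\<epsilon> * e $ i \<le> \<epsilon> * (\<Sum>i\<in>UNIV. e $ i)"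
          using e0 \<open>0 < \<epsilon>\<close> by (intro mult_left_mono member_le_sum) auto
        also have "\<dots> = m"
          using s by (simp add: \<epsilon>_def)
        also have "m \<le> v $ i"
          unfolding m_def using True by (intro Min_le) auto
        finally show ?thesis .
      next
        case False
        then show ?thesis
          using v0 e(4) by (simp add: less_eq_vec_def)
      qed
      then have "d + \<epsilon> *\<^sub>R e \<in> D"
        using d e(2) e0 \<open>0 < \<epsilon>\<close>
        by (auto simp: D_def v_def less_eq_vec_def matrix_vector_right_distrib
            matrix_vector_mult_scaleR algebra_simps)
      from max[OF this] have "\<epsilon> * (\<Sum>i\<in>UNIV. e $ i) \<le> 0"
        by (simp add: sum.distrib sum_distrib_left)
      then show False
        using s \<open>0 < \<epsilon>\<close> by (simp add: mult_le_0_iff)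
    qed
    ultimately have "norm v \<le> B"
      using B(2) by blast
    then show "\<exists>v d. x = v + d \<and> norm v \<le> B \<and> 0 \<le> v \<and> 0 \<le> d \<and> A *v d = 0"
      using v0 d0 by (intro exI[of _ v] exI[of _ d]) (simp add: v_def)
  qed (use B(1) in simp)
qed

text \<open>In the expansion at \<open>v + d\<close> the term in \<open>d\<close> alone is
  nonnegative by \<open>rec\<close>, the term in \<open>v\<close> alone is bounded, and the mixed
  and linear terms decrease at most linearly in the coordinate sum.\<close>

lemma qp_objective_affine_minorant:
  fixes Q :: "real^'n^'n" and A :: "real^'n^'m"
  assumes rec: "\<And>d. A *v d = 0 \<Longrightarrow> 0 \<le> d \<Longrightarrow> d \<bullet> (Q *v d) \<ge> 0"
  obtains \<alpha> \<beta> where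
    "convex_underestimator (qp_objective Q c) (qp_feasible A b) (\<lambda>x. \<alpha> + \<beta> * (\<Sum>i\<in>UNIV. x $ i))"
proof -
  obtain B where B: "0 \<le> B" and dec: "\<And>x. x \<in> qp_feasible A b \<Longrightarrow>
       \<exists>v d. x = v + d \<and> norm v \<le> B \<and> 0 \<le> v \<and> 0 \<le> d \<and> A *v d = 0"
    using qp_feasible_decompose[of A b] by metis
  obtain K where K: "0 < K" "\<And>x. norm (Q *v x) \<le> norm x * K"
    using bounded_linear.pos_bounded[OF matrix_vector_mul_bounded_linear[of Q]] by blast
  have bil: "- (norm x * norm y * K) \<le> x \<bullet> (Q *v y)" for x y
  proof -
    have "\<bar>x \<bullet> (Q *v y)\<bar> \<le> norm x * norm (Q *v y)"
      by (rule Cauchy_Schwarz_ineq2)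
    also have "\<dots> \<le> norm x * (norm y * K)"
      using K by (intro mult_left_mono) auto
    finally show ?thesis
      by (simp add: mult.assoc)
  qed
  \<comment> \<open>On the nonnegative orthant the coordinate sum is the l1 norm: a linear function
    that dominates the Euclidean norm.\<close>
  have l1: "norm y \<le> (\<Sum>i\<in>UNIV. y $ i)" if "0 \<le> y" for y :: "real^'n"
    using norm_le_l1_cart[of y] that by (simp add: less_eq_vec_def)
  \<comment> \<open>\<open>\<alpha>\<close> absorbs the term in \<open>v\<close> alone;
    \<open>\<beta>\<close> absorbs the two mixed terms and the linear term of the objective.\<close>
  define \<alpha> where "\<alpha> = - (B * B * K)"
  define \<beta> where "\<beta> = - (2 * B * K + 2 * norm c)"
  have "\<alpha> + \<beta> * (\<Sum>i\<in>UNIV. x $ i) \<le> qp_objective Q c x" if x: "x \<in> qp_feasible A b" for x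
  proof -
    obtain v d where vd: "x = v + d" "norm v \<le> B" "0 \<le> v" "0 \<le> d" "A *v d = 0"
      using dec[OF x] by blast
    have "norm d \<le> (\<Sum>i\<in>UNIV. d $ i)"
      using vd(4) by (rule l1)
    also have "\<dots> \<le> (\<Sum>i\<in>UNIV. x $ i)"
      using vd(3) by (intro sum_mono) (simp add: vd(1) less_eq_vec_def)
    finally have d: "norm d \<le> (\<Sum>i\<in>UNIV. x $ i)" .
    have "norm v * norm v * K \<le> B * B * K"
      using vd(2) B K by (intro mult_right_mono mult_mono) auto
    then have vv: "- (B * B * K) \<le> v \<bullet> (Q *v v)"
      using bil[of v v] by linarith
    have "norm v * norm d * K \<le> B * (\<Sum>i\<in>UNIV. x $ i) * K"
      using vd(2) B K d by (intro mult_right_mono mult_mono) auto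
    then have vd': "- (B * (\<Sum>i\<in>UNIV. x $ i) * K) \<le> v \<bullet> (Q *v d)"
      and dv: "- (B * (\<Sum>i\<in>UNIV. x $ i) * K) \<le> d \<bullet> (Q *v v)"
      using bil[of v d] bil[of d v] by (auto simp: mult.commute)
    have dd: "0 \<le> d \<bullet> (Q *v d)"
      using rec vd by blast
    have "\<bar>c \<bullet> x\<bar> \<le> norm c * norm x"
      by (rule Cauchy_Schwarz_ineq2)
    also have "\<dots> \<le> norm c * (\<Sum>i\<in>UNIV. x $ i)"
      using x by (intro mult_left_mono l1) (auto simp: qp_feasible_def)
    finally have cx: "- (norm c * (\<Sum>i\<in>UNIV. x $ i)) \<le> c \<bullet> x"
      by linarith
    have "x \<bullet> (Q *v x) = v \<bullet> (Q *v v) + v \<bullet> (Q *v d) + d \<bullet> (Q *v v) + d \<bullet> (Q *v d)"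
      by (simp add: vd(1) matrix_vector_right_distrib inner_add_left inner_add_right)
    moreover have "\<alpha> + \<beta> * (\<Sum>i\<in>UNIV. x $ i) = - (B * B * K)
        - 2 * (B * (\<Sum>i\<in>UNIV. x $ i) * K) - 2 * (norm c * (\<Sum>i\<in>UNIV. x $ i))"
      by (simp add: \<alpha>_def \<beta>_def algebra_simps)
    ultimately show ?thesis
      unfolding qp_objective_def using vv vd' dv dd cx by linarith
  qed
  moreover have "convex_on (qp_feasible A b) (\<lambda>x. \<alpha> + \<beta> * (\<Sum>i\<in>UNIV. x $ i))"
    by (intro convex_onI convex_qp_feasible)
      (simp add: sum.distrib algebra_simps sum_subtractf flip: sum_distrib_left)
  ultimately show thesis
    by (intro that) (auto simp: convex_underestimator_def)
qed

section \<open>The lifted value as a convex envelope\<close>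

text \<open>Jensen's inequality is applied to the decomposition of \<open>Y\<close>; the remainder
  \<open>\<rho>\<close> only raises the right-hand side.\<close>

lemma convex_underestimator_le_lifted_objective:
  fixes Q :: "real^'n^'n" and A :: "real^'n^'m"
  assumes rec: "\<And>d. A *v d = 0 \<Longrightarrow> 0 \<le> d \<Longrightarrow> d \<bullet> (Q *v d) \<ge> 0"
    and g: "convex_underestimator (qp_objective Q c) (qp_feasible A b) g"
    and Y: "Y \<in> lifted_feasible_at completely_positive A b x"
  shows "g x \<le> lifted_objective Q c \<bullet> Y"
proof -
  have Y': "Y \<in> lifted_feasible completely_positive A b" and x: "(\<chi> i. Y $ None $ Some i) = x"
    using Y by (auto simp: lifted_feasible_at_def)
  obtain J :: "nat set" and w X \<rho> where J: "finite J" "\<forall>j\<in>J. 0 < w j"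
    "\<forall>j\<in>J. X j \<in> qp_feasible A b" "sum w J = 1"
    "(\<chi> i. Y $ None $ Some i) = (\<Sum>j\<in>J. w j *\<^sub>R X j)"
    "lifted_objective Q c \<bullet> Y = (\<Sum>j\<in>J. w j * qp_objective Q c (X j)) + \<rho>" "0 \<le> \<rho>"
    by (rule lifted_feasible_decompose[OF Y' rec])
  have "g x = g (\<Sum>j\<in>J. w j *\<^sub>R X j)"
    using J(5) x by simp
  also have "\<dots> \<le> (\<Sum>j\<in>J. w j * g (X j))"
    using J g by (intro convex_on_sum[of J "qp_feasible A b"])
      (auto simp: convex_underestimator_def less_imp_le)
  also have "\<dots> \<le> (\<Sum>j\<in>J. w j * qp_objective Q c (X j))"
    using J g by (intro sum_mono mult_left_mono) (auto simp: convex_underestimator_def less_imp_le)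
  finally show ?thesis
    using J by simp
qed

lemma lifted_value_at_eq_convex_envelope:
  fixes Q :: "real^'n^'n" and A :: "real^'n^'m"
  assumes rec: "\<And>d. A *v d = 0 \<Longrightarrow> 0 \<le> d \<Longrightarrow> d \<bullet> (Q *v d) \<ge> 0"
    and x: "x \<in> qp_feasible A b"
  shows "lifted_value_at completely_positive Q c A b x
           = convex_envelope (qp_objective Q c) (qp_feasible A b) x"
proof (rule antisym)
  show "convex_envelope (qp_objective Q c) (qp_feasible A b) x
      \<le> lifted_value_at completely_positive Q c A b x"
    unfolding convex_envelope_def lifted_value_at_def
    by (intro SUP_least INF_greatest)
      (auto intro: convex_underestimator_le_lifted_objective[OF rec])
next
  let ?S = "qp_feasible A b"
  let ?F = "lifted_feasible_at completely_positive A b"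
  let ?v = "\<lambda>Y. lifted_objective Q c \<bullet> Y"
  \<comment> \<open>A real infimum, since underestimators are real valued. It is meaningful on
    \<open>?S\<close>: the affine minorant bounds each fibre below, and rank one lifts make the
    fibres there nonempty.\<close>
  define h where "h y = (INF Y \<in> ?F y. ?v Y)" for y
  obtain \<alpha> \<beta> where "convex_underestimator (qp_objective Q c) ?S (\<lambda>x. \<alpha> + \<beta> * (\<Sum>i\<in>UNIV. x $ i))"
    using qp_objective_affine_minorant[OF rec] by metis
  then have bdd: "bdd_below (?v ` ?F y)" for y
    using convex_underestimator_le_lifted_objective[OF rec] by (intro bdd_belowI2) blast
  have ne: "?F y \<noteq> {}" if "y \<in> ?S" for y
    using lifted_feasible_at_outer_square(1)[OF that] by blast
  have h_le: "h y \<le> ?v Y" if "Y \<in> ?F y" for y Y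
    unfolding h_def using bdd that by (rule cINF_lower)
  \<comment> \<open>The infimum over a fibre may fail to be attained, so near-minimizers with
    arbitrary slack \<open>e\<close> take the place of minimizers.\<close>
  have approx: "\<exists>Y\<in>?F y. ?v Y < h y + e" if "y \<in> ?S" "0 < e" for y e
    using cINF_less_iff[OF ne[OF that(1)] bdd, of "h y + e"] that(2) by (simp add: h_def)
  have "convex_on ?S h"
    unfolding convex_on_def
  proof (intro conjI convex_qp_feasible ballI allI impI)
    fix y z u v
    assume yz: "y \<in> ?S" "z \<in> ?S" and uv: "0 \<le> u" "0 \<le> v" "u + v = (1::real)"
    show "h (u *\<^sub>R y + v *\<^sub>R z) \<le> u * h y + v * h z"
    proof (rule field_le_epsilon)
      fix e :: real assume e: "0 < e"
      obtain Y where Y: "Y \<in> ?F y" "?v Y < h y + e"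
        using approx yz e by blast
      obtain Z where Z: "Z \<in> ?F z" "?v Z < h z + e"
        using approx yz e by blast
      have "h (u *\<^sub>R y + v *\<^sub>R z) \<le> ?v (u *\<^sub>R Y + v *\<^sub>R Z)"
        by (intro h_le lifted_feasible_at_convex_combination Y Z uv)
      also have "\<dots> = u * ?v Y + v * ?v Z"
        by (simp add: inner_add_right)
      also have "\<dots> \<le> u * (h y + e) + v * (h z + e)"
        using Y Z uv by (intro add_mono mult_left_mono) auto
      also have "\<dots> = u * h y + v * h z + (u + v) * e"
        by (simp add: algebra_simps)
      finally show "h (u *\<^sub>R y + v *\<^sub>R z) \<le> u * h y + v * h z + e"
        by (simp add: uv)
    qed
  qed
  moreover have "h y \<le> qp_objective Q c y" if "y \<in> ?S" for y
    using h_le[OF lifted_feasible_at_outer_square(1)[OF that]]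
    by (simp add: lifted_feasible_at_outer_square(2)[OF that])
  ultimately have "convex_underestimator (qp_objective Q c) ?S h"
    by (simp add: convex_underestimator_def)
  then have "ereal (h x) \<le> convex_envelope (qp_objective Q c) ?S x"
    unfolding convex_envelope_def by (intro SUP_upper) simp
  moreover have "lifted_value_at completely_positive Q c A b x \<le> ereal (h x)"
  proof (rule ereal_le_epsilon2)
    fix e :: real assume "0 < e"
    then obtain Y where Y: "Y \<in> ?F x" "?v Y < h x + e"
      using approx x by blast
    have "lifted_value_at completely_positive Q c A b x \<le> ereal (?v Y)"
      unfolding lifted_value_at_def using Y(1) by (rule INF_lower)
    also have "\<dots> \<le> ereal (h x) + ereal e"
      using Y(2) by simp
    finally show "lifted_value_at completely_positive Q c A b x \<le> ereal (h x) + ereal e" .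
  qed
  ultimately show "lifted_value_at completely_positive Q c A b x \<le> convex_envelope (qp_objective Q c) ?S x"
    by (rule order_trans[rotated])
qed

section \<open>Optimal values and solutions\<close>

text \<open>A finite optimal value is itself a constant convex underestimator, so the Jensen bound
  applies; the two infinite values are treated separately.\<close>

lemma qp_value_le_lifted_objective:
  fixes Q :: "real^'n^'n" and A :: "real^'n^'m"
  assumes rec: "\<And>d. A *v d = 0 \<Longrightarrow> 0 \<le> d \<Longrightarrow> d \<bullet> (Q *v d) \<ge> 0"
    and Y: "Y \<in> lifted_feasible completely_positive A b"
  shows "qp_value Q c A b \<le> ereal (lifted_objective Q c \<bullet> Y)"
proof (cases "qp_value Q c A b")
  case (real l)
  have l: "l \<le> qp_objective Q c x" if "x \<in> qp_feasible A b" for x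
    using INF_lower[OF that, of "\<lambda>x. ereal (qp_objective Q c x)"] real
    by (simp add: qp_value_def)
  then have "convex_underestimator (qp_objective Q c) (qp_feasible A b) (\<lambda>_. l)"
    by (simp add: convex_underestimator_def convex_on_def convex_qp_feasible
        flip: distrib_right)
  from convex_underestimator_le_lifted_objective[OF rec this, of Y] Y real show ?thesis
    by (simp add: lifted_feasible_at_def)
next
  case PInf
  have "qp_feasible A b = {}"
  proof (rule ccontr)
    assume "qp_feasible A b \<noteq> {}"
    then obtain x where "x \<in> qp_feasible A b"
      by blast
    from INF_lower[OF this, of "\<lambda>x. ereal (qp_objective Q c x)"] PInf show False
      by (simp add: qp_value_def)
  qed
  \<comment> \<open>With no feasible points the index set \<open>J\<close> must be empty, which
    contradicts weights of total 1; hence no lifted feasible \<open>Y\<close> exists.\<close>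
  moreover obtain J :: "nat set" and w X \<rho> where "finite J" "\<forall>j\<in>J. 0 < w j"
    "\<forall>j\<in>J. X j \<in> qp_feasible A b" "sum w J = 1"
    "(\<chi> i. Y $ None $ Some i) = (\<Sum>j\<in>J. w j *\<^sub>R X j)"
    "lifted_objective Q c \<bullet> Y = (\<Sum>j\<in>J. w j * qp_objective Q c (X j)) + \<rho>" "0 \<le> \<rho>"
    by (rule lifted_feasible_decompose[OF Y rec])
  ultimately show ?thesis
    by (cases "J = {}") auto
qed simp

text \<open>The lower bound holds matrix by matrix, and rank one lifts give the opposite inequality.
  This covers infinite values and an empty feasible region too.\<close>

lemma lifted_value_eq_qp_value:
  fixes Q :: "real^'n^'n" and A :: "real^'n^'m"
  assumes rec: "\<And>d. A *v d = 0 \<Longrightarrow> 0 \<le> d \<Longrightarrow> d \<bullet> (Q *v d) \<ge> 0"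
  shows "lifted_value completely_positive Q c A b = qp_value Q c A b"
proof (rule antisym)
  show "qp_value Q c A b \<le> lifted_value completely_positive Q c A b"
    unfolding lifted_value_def by (intro INF_greatest qp_value_le_lifted_objective[OF rec])
  show "lifted_value completely_positive Q c A b \<le> qp_value Q c A b"
    unfolding lifted_value_def qp_value_def
  proof (rule INF_greatest)
    fix x assume x: "x \<in> qp_feasible A b"
    then show "(INF Y \<in> lifted_feasible completely_positive A b. ereal (lifted_objective Q c \<bullet> Y))
        \<le> ereal (qp_objective Q c x)"
      using lifted_feasible_at_outer_square(1)[OF x] lifted_feasible_at_outer_square(2)[OF x, of Q c]
      by (intro INF_lower2[of "outer_square (homogenized 1 x)"]) (auto simp: lifted_feasible_at_def)
  qed
qed

text \<open>Forward, the feasible points in the decomposition of an optimal matrix all turn out to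
  be solutions; backward, rank one lifts of solutions are averaged.\<close>

lemma lifted_attains_qp_value_iff:
  fixes Q :: "real^'n^'n" and A :: "real^'n^'m"
  assumes rec: "\<And>d. A *v d = 0 \<Longrightarrow> 0 \<le> d \<Longrightarrow> d \<bullet> (Q *v d) \<ge> 0"
  shows "lifted_value_at completely_positive Q c A b x = qp_value Q c A b
           \<and> lifted_attained_at completely_positive Q c A b x
         \<longleftrightarrow> x \<in> convex hull (qp_solutions Q c A b)"
proof (intro iffI)
  assume "lifted_value_at completely_positive Q c A b x = qp_value Q c A b
           \<and> lifted_attained_at completely_positive Q c A b x"
  then obtain Y where Y: "Y \<in> lifted_feasible completely_positive A b"
    and x: "(\<chi> i. Y $ None $ Some i) = x"
    and val: "qp_value Q c A b = ereal (lifted_objective Q c \<bullet> Y)"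
    by (auto simp: lifted_attained_at_def lifted_feasible_at_def)
  obtain J :: "nat set" and w X \<rho> where J: "finite J" "\<forall>j\<in>J. 0 < w j"
    "\<forall>j\<in>J. X j \<in> qp_feasible A b" "sum w J = 1"
    "(\<chi> i. Y $ None $ Some i) = (\<Sum>j\<in>J. w j *\<^sub>R X j)"
    "lifted_objective Q c \<bullet> Y = (\<Sum>j\<in>J. w j * qp_objective Q c (X j)) + \<rho>" "0 \<le> \<rho>"
    by (rule lifted_feasible_decompose[OF Y rec])
  define l where "l = lifted_objective Q c \<bullet> Y"
  have l: "l \<le> qp_objective Q c (X j)" if "j \<in> J" for j
    using INF_lower[OF bspec[OF J(3) that], of "\<lambda>x. ereal (qp_objective Q c x)"] val
    by (simp add: qp_value_def l_def)
  \<comment> \<open>The excesses over \<open>l\<close> are nonnegative, while their weighted sum is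
    \<open>- \<rho>\<close>, at most 0; positive weights then force every excess to vanish.\<close>
  have "(\<Sum>j\<in>J. w j * (qp_objective Q c (X j) - l))
      = (\<Sum>j\<in>J. w j * qp_objective Q c (X j)) - sum w J * l"
    by (simp add: right_diff_distrib sum_subtractf sum_distrib_right)
  also have "\<dots> \<le> 0"
    using J(4,6,7) by (simp add: l_def)
  finally have le0: "(\<Sum>j\<in>J. w j * (qp_objective Q c (X j) - l)) \<le> 0" .
  have nonneg: "0 \<le> w j * (qp_objective Q c (X j) - l)" if "j \<in> J" for j
    using l J(2) that by (simp add: less_imp_le)
  have "(\<Sum>j\<in>J. w j * (qp_objective Q c (X j) - l)) = 0"
    using le0 nonneg by (intro antisym sum_nonneg)
  then have "w j * (qp_objective Q c (X j) - l) = 0" if "j \<in> J" for j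
    using sum_nonneg_eq_0_iff[of J "\<lambda>j. w j * (qp_objective Q c (X j) - l)"] J(1) nonneg that
    by simp
  then have "qp_objective Q c (X j) = l" if "j \<in> J" for j
    using J(2) that by force
  then have "X j \<in> convex hull (qp_solutions Q c A b)" if "j \<in> J" for j
    using that J(3) val by (intro hull_inc) (simp add: qp_solutions_def l_def)
  then have "(\<Sum>j\<in>J. w j *\<^sub>R X j) \<in> convex hull (qp_solutions Q c A b)"
    using J by (intro convex_sum) (auto simp: less_imp_le)
  then show "x \<in> convex hull (qp_solutions Q c A b)"
    using J(5) x by simp
next
  \<comment> \<open>The points over which some lifted matrix reaches the optimal value. This set is
    convex and contains all solutions, hence also their convex hull.\<close>
  let ?C = "{x. \<exists>Y \<in> lifted_feasible_at completely_positive A b x.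
     ereal (lifted_objective Q c \<bullet> Y) = qp_value Q c A b}"
  assume x: "x \<in> convex hull (qp_solutions Q c A b)"
  have "convex ?C"
    unfolding convex_def
  proof (intro ballI allI impI)
    fix y z u v
    assume "y \<in> ?C" "z \<in> ?C" and uv: "0 \<le> u" "0 \<le> v" "u + v = (1::real)"
    then obtain Y Z where Y: "Y \<in> lifted_feasible_at completely_positive A b y"
      "ereal (lifted_objective Q c \<bullet> Y) = qp_value Q c A b"
      and Z: "Z \<in> lifted_feasible_at completely_positive A b z"
      "ereal (lifted_objective Q c \<bullet> Z) = qp_value Q c A b"
      by auto
    have "lifted_objective Q c \<bullet> Z = lifted_objective Q c \<bullet> Y"
      using Y(2) Z(2) by (metis ereal.inject)
    then have "lifted_objective Q c \<bullet> (u *\<^sub>R Y + v *\<^sub>R Z) = (u + v) * (lifted_objective Q c \<bullet> Y)"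
      by (simp add: inner_add_right distrib_right)
    then show "u *\<^sub>R y + v *\<^sub>R z \<in> ?C"
      using lifted_feasible_at_convex_combination[OF Y(1) Z(1) uv] Y(2) uv(3)
      by (auto intro!: bexI[of _ "u *\<^sub>R Y + v *\<^sub>R Z"])
  qed
  moreover have "qp_solutions Q c A b \<subseteq> ?C"
  proof
    fix y assume "y \<in> qp_solutions Q c A b"
    then have y: "y \<in> qp_feasible A b" "ereal (qp_objective Q c y) = qp_value Q c A b"
      by (auto simp: qp_solutions_def)
    show "y \<in> ?C"
      using lifted_feasible_at_outer_square(1)[OF y(1)]
        lifted_feasible_at_outer_square(2)[OF y(1), of Q c] y(2)
      by (intro CollectI bexI[of _ "outer_square (homogenized 1 y)"]) simp_all
  qed
  ultimately have "convex hull (qp_solutions Q c A b) \<subseteq> ?C"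
    by (intro hull_minimal)
  with x have "x \<in> ?C"
    by (rule rev_subsetD)
  then obtain Y where Y: "Y \<in> lifted_feasible_at completely_positive A b x"
    and val: "ereal (lifted_objective Q c \<bullet> Y) = qp_value Q c A b"
    by blast
  have "lifted_value_at completely_positive Q c A b x = qp_value Q c A b"
  proof (rule antisym)
    show "lifted_value_at completely_positive Q c A b x \<le> qp_value Q c A b"
      unfolding val[symmetric] lifted_value_at_def using Y by (rule INF_lower)
    show "qp_value Q c A b \<le> lifted_value_at completely_positive Q c A b x"
      unfolding lifted_value_at_def
      by (intro INF_greatest qp_value_le_lifted_objective[OF rec])
        (auto simp: lifted_feasible_at_def)
  qed
  then show "lifted_value_at completely_positive Q c A b x = qp_value Q c A b
           \<and> lifted_attained_at completely_positive Q c A b x"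
    using Y val by (auto simp: lifted_attained_at_def)
qed

theorem proposition5p6:
  fixes Q :: "real^'n^'n" and c :: "real^'n" and A :: "real^'n^'m" and b :: "real^'m"
  assumes "transpose Q = Q"
    and "\<not> bounded (qp_feasible A b)"
    and "\<And>d. A *v d = 0 \<Longrightarrow> 0 \<le> d \<Longrightarrow> d \<bullet> (Q *v d) \<ge> 0"
  shows "(\<forall>x \<in> qp_feasible A b.
            lifted_value_at completely_positive Q c A b x
              = convex_envelope (qp_objective Q c) (qp_feasible A b) x)
       \<and> lifted_value completely_positive Q c A b = qp_value Q c A b
       \<and> (\<forall>x \<in> qp_feasible A b.
            (lifted_value_at completely_positive Q c A b x = qp_value Q c A b
               \<and> lifted_attained_at completely_positive Q c A b x)
            \<longleftrightarrow> x \<in> convex hull (qp_solutions Q c A b))"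
  using lifted_value_at_eq_convex_envelope[OF assms(3)] lifted_value_eq_qp_value[OF assms(3)]
    lifted_attains_qp_value_iff[OF assms(3)]
  by blast

end
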